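(* Fix an integer $n\ge4$. For any integer $k$ with $2\le k\le n-2$, there exist $\delta>0$ and a random subset $\mathcal X^{(k)}$ of $[n]=\{1,\ldots,n\}$, with $Q_k(A):=\mathbb P(\mathcal X^{(k)}=A)$ depending only on $|A|$ for $A\subseteq[n]$, such that the following hold (here $j$ denotes an integer and $\alpha$ a positive real number). (1) $Q_k(A)=0$ if and only if $A=\emptyset$ or $1<|A|\le n-k+1$. (2) $\mathcal X^{(k)}_\alpha$ does not exist if $\alpha\le n-k-1$ and $\alpha$ is non-integer. (3) $\mathcal X^{(k)}_\alpha$ exists when $\alpha\in[j,j+\delta)$, for all $n-k\le j\le n-2$. (4) For every $n-k\le j\le n-2$, $\mathcal X^{(k)}_{\alpha_j}$ does not exist for some $\alpha_j\in(j,j+1)$. (5) For every $B\subseteq[n]$ with $|B|\ge n-k+2$, $$r_{k,B}(\alpha):=\sum_{A\subseteq B}(-1)^{|B|-|A|}\,\mathbb P\{\mathcal X^{(k)}\subseteq A\}^\alpha>0$$ for $\alpha\in(j-\delta,j+\delta)$, for all $1\le j\le n-2$.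
   Context: A random subset $\mathcal X$ of $[n]$ is a random variable taking values in the set of all subsets of $[n]$ (the empty set is allowed as a value). Its void functional is $V_{\mathcal X}(K)=\mathbb P\{\mathcal X\cap K=\emptyset\}$, $K\subseteq[n]$. For $\alpha>0$, we say that $\mathcal X_\alpha$ exists if there is a random subset $\mathcal Y$ of $[n]$ (on some probability space) with $V_{\mathcal Y}(K)=V_{\mathcal X}(K)^\alpha$ for all $K\subseteq[n]$. The convention $0^\alpha=0$ for $\alpha>0$ is used. *)

theory Defs
  imports "HOL-Probability.Probability"
begin

definition random_subset :: "nat \<Rightarrow> 'a measure \<Rightarrow> ('a \<Rightarrow> nat set) \<Rightarrow> bool" where
  "random_subset n M X \<longleftrightarrow> prob_space M \<and> X \<in> M \<rightarrow>\<^sub>M count_space (Pow {1..n})"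

definition void_functional :: "'a measure \<Rightarrow> ('a \<Rightarrow> nat set) \<Rightarrow> nat set \<Rightarrow> real" where
  "void_functional M X K = \<P>(\<omega> in M. X \<omega> \<inter> K = {})"

text \<open>
  HOL cannot quantify existentially over the type of the sample space, so the probability
  space carrying \<open>Y\<close> is taken over \<open>nat set\<close>. This is no restriction: see
  \<open>power_existsI\<close> below. Note that \<open>0 powr \<alpha> = 0\<close>.
\<close>
definition power_exists :: "nat \<Rightarrow> 'a measure \<Rightarrow> ('a \<Rightarrow> nat set) \<Rightarrow> real \<Rightarrow> bool" where
  "power_exists n M X \<alpha> \<longleftrightarrow>
     (\<exists>(N :: nat set measure) Y. random_subset n N Y \<and>
        (\<forall>K \<subseteq> {1..n}. void_functional N Y K = void_functional M X K powr \<alpha>))"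

definition subset_alt_sum :: "'a measure \<Rightarrow> ('a \<Rightarrow> nat set) \<Rightarrow> nat set \<Rightarrow> real \<Rightarrow> real" where
  "subset_alt_sum M X B \<alpha> =
     (\<Sum>A \<in> Pow B. (-1) ^ (card B - card A) * \<P>(\<omega> in M. X \<omega> \<subseteq> A) powr \<alpha>)"

lemma random_subset_law:
  fixes N :: "'b measure"
  assumes "random_subset n N Y"
  defines "L \<equiv> distr N (count_space (Pow {1..n})) Y"
  shows "random_subset n L (\<lambda>A. A)"
    and "void_functional L (\<lambda>A. A) K = void_functional N Y K"
proof -
  have ps: "prob_space N" and m: "Y \<in> N \<rightarrow>\<^sub>M count_space (Pow {1..n})"
    using assms(1) by (auto simp: random_subset_def)
  show "random_subset n L (\<lambda>A. A)"
    unfolding random_subset_def L_def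
    using prob_space.prob_space_distr[OF ps m] by simp
  have "Y -` {A \<in> Pow {1..n}. A \<inter> K = {}} \<inter> space N = {\<omega> \<in> space N. Y \<omega> \<inter> K = {}}"
    using measurable_space[OF m] by auto
  moreover have "measure L {A \<in> Pow {1..n}. A \<inter> K = {}} =
      measure N (Y -` {A \<in> Pow {1..n}. A \<inter> K = {}} \<inter> space N)"
    unfolding L_def by (rule measure_distr[OF m]) auto
  moreover have "{A \<in> space L. A \<inter> K = {}} = {A \<in> Pow {1..n}. A \<inter> K = {}}"
    by (simp add: L_def)
  ultimately show "void_functional L (\<lambda>A. A) K = void_functional N Y K"
    unfolding void_functional_def by simp
qed

lemma power_existsI:
  fixes N :: "'b measure"
  assumes "random_subset n N Y"
    and "\<And>K. K \<subseteq> {1..n} \<Longrightarrow> void_functional N Y K = void_functional M X K powr \<alpha>"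
  shows "power_exists n M X \<alpha>"
  unfolding power_exists_def using random_subset_law[OF assms(1)] assms(2) by metis

end

theory Submission imports Defs begin

text \<open>
  Moebius inversion on the subsets of \<open>{1..n}\<close> recovers the law of a random subset from the
  probabilities \<open>F(A)\<close> that it lies inside \<open>A\<close>. Hence \<open>X\<^sub>\<alpha>\<close> exists exactly when the Moebius
  inverse of \<open>F\<^sup>\<alpha>\<close>, which is \<open>subset_alt_sum\<close>, has no negative value
  (lemma \<open>power_exists_iff\<close>). If the law depends only on cardinalities, then \<open>F(A) = f(card A)\<close>
  up to a constant factor, and the value at \<open>B\<close> is, up to a positive factor, the forward difference
  of order \<open>card B\<close> at 0 of the sequence \<open>f(i)\<^sup>\<alpha>\<close> (lemma \<open>exchangeable_subset\<close>).

  The example puts weight 1 on each singleton and a small weight \<open>\<epsilon> > 0\<close> on each set with at least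
  \<open>s = n - k + 2\<close> elements. Then \<open>f(i) = i\<close> for \<open>i < s\<close>, and \<open>f(i)\<close> tends to \<open>i\<close> for all \<open>i\<close>
  as \<open>\<epsilon>\<close> tends to 0.

  By the mean value theorem, for \<open>m \<ge> 1\<close> the \<open>m\<close>-th difference at 0 of \<open>i\<^sup>\<alpha>\<close> is
  \<open>\<alpha> (\<alpha> - 1) \<dots> (\<alpha> - m + 1)\<close> times a positive number (lemma \<open>fwd_diff_powr\<close>). For
  \<open>j \<le> \<alpha> < j + 1\<close> it is therefore nonnegative for \<open>m \<le> j + 1\<close>, and for \<open>j < \<alpha> < j + 1\<close> it is
  negative for \<open>m = j + 2\<close>.
  If \<open>j + 2 < s\<close>, this difference only involves the linear part of \<open>f\<close>, and \<open>X\<^sub>\<alpha>\<close> does not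
  exist. If \<open>s \<le> j + 2 \<le> n\<close>, it still is negative at \<open>\<alpha> = j + 1/2\<close> when \<open>\<epsilon>\<close> is small enough.

  For a positive integer \<open>j\<close>, the Moebius inverse of \<open>F\<^sup>j\<close> is the law of the union of \<open>j\<close> independent
  copies of \<open>X\<close>, so it is positive wherever the law of \<open>X\<close> is, in particular at all sets with at least \<open>s\<close>
  elements (lemma \<open>subset_alt_sum_nat_pos\<close>). By continuity in \<open>\<alpha>\<close> it remains positive on an
  interval around \<open>j\<close>. For \<open>j \<ge> n - k\<close> and \<open>\<alpha> \<in> [j, j + \<delta>)\<close>, the smaller sets, with at most
  \<open>n - k + 1 \<le> j + 1\<close> elements, are covered by the nonnegativity for \<open>m \<le> j + 1\<close>; so
  \<open>X\<^sub>\<alpha>\<close> exists.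
\<close>

section \<open>Forward differences of powers\<close>

text \<open>
  The \<open>m\<close>-fold iterate of \<open>a \<mapsto> (\<lambda>i. a (i + 1) - a i)\<close>, evaluated at 0. The expanded form is the one that
  arises from alternating sums over the subsets of an \<open>m\<close>-element set.
\<close>

definition fwd_diff :: "nat \<Rightarrow> (nat \<Rightarrow> real) \<Rightarrow> real" where
  "fwd_diff m a = (\<Sum>i\<le>m. (-1) ^ (m - i) * real (m choose i) * a i)"

lemma fwd_diff_0 [simp]: "fwd_diff 0 a = a 0"
  by (simp add: fwd_diff_def)

lemma fwd_diff_Suc: "fwd_diff (Suc m) a = fwd_diff m (\<lambda>i. a (Suc i)) - fwd_diff m a"
proof -
  have "fwd_diff m a = (\<Sum>i\<le>Suc m. (-1) ^ (m - i) * real (m choose i) * a i)"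
    by (simp add: fwd_diff_def)
  also have "\<dots> = (-1) ^ m * a 0 + (\<Sum>i\<le>m. (-1) ^ (m - Suc i) * real (m choose Suc i) * a (Suc i))"
    by (subst sum.atMost_Suc_shift) simp
  finally have 1: "fwd_diff m a = \<dots>" .
  \<comment> \<open>At \<open>i = m\<close> the subtraction \<open>m - Suc i\<close> is truncated, but there the binomial coefficient vanishes.\<close>
  have 2: "(-1) ^ (m - i) * real (m choose Suc i) = - ((-1) ^ (m - Suc i) * real (m choose Suc i))"
    if "i \<le> m" for i
  proof (cases "i = m")
    case False
    with that have "m - i = Suc (m - Suc i)" by simp
    then show ?thesis by simp
  qed simp
  have "fwd_diff (Suc m) a = (-1) ^ Suc m * a 0
      + (\<Sum>i\<le>m. (-1) ^ (m - i) * (real (m choose i) + real (m choose Suc i)) * a (Suc i))"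
    unfolding fwd_diff_def by (subst sum.atMost_Suc_shift) simp
  also have "(\<Sum>i\<le>m. (-1) ^ (m - i) * (real (m choose i) + real (m choose Suc i)) * a (Suc i))
      = fwd_diff m (\<lambda>i. a (Suc i))
        - (\<Sum>i\<le>m. (-1) ^ (m - Suc i) * real (m choose Suc i) * a (Suc i))"
    unfolding fwd_diff_def sum_subtractf[symmetric]
    by (rule sum.cong) (use 2 in \<open>auto simp: algebra_simps\<close>)
  finally show ?thesis using 1 by simp
qed

text \<open>
  The difference of order \<open>m + 1\<close> is the increment over \<open>[x, x + 1]\<close> of the difference of order
  \<open>m\<close>, viewed as a function of the base point, and differentiation commutes with taking
  differences. The mean value theorem needs the derivative only in the interior, so \<open>x = 0\<close> is
  admissible as long as the power is continuous there, that is, for a positive exponent.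
\<close>

lemma fwd_diff_powr_step:
  fixes x \<beta> :: real
  assumes "0 < x \<or> x = 0 \<and> 0 < \<beta>"
  obtains z where "0 < z"
    and "fwd_diff (Suc m) (\<lambda>i. (x + real i) powr \<beta>) = \<beta> * fwd_diff m (\<lambda>i. (z + real i) powr (\<beta> - 1))"
proof -
  define g where "g y = fwd_diff m (\<lambda>i. (y + real i) powr \<beta>)" for y
  have cont: "continuous_on {x..x + 1} g"
    unfolding g_def fwd_diff_def using assms
    by (intro continuous_intros continuous_on_powr') auto
  have deriv: "(g has_real_derivative \<beta> * fwd_diff m (\<lambda>i. (y + real i) powr (\<beta> - 1))) (at y)"
    if "x < y" for y
  proof -
    have "((\<lambda>y. (y + real i) powr \<beta>) has_real_derivative \<beta> * (y + real i) powr (\<beta> - 1)) (at y)" for i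
      using DERIV_fun_powr[of "\<lambda>y. y + real i" 1 y \<beta>] assms that
      by (auto intro!: derivative_eq_intros)
    then have "(g has_real_derivative
        (\<Sum>i\<le>m. (-1) ^ (m - i) * real (m choose i) * (\<beta> * (y + real i) powr (\<beta> - 1)))) (at y)"
      unfolding g_def fwd_diff_def by (intro DERIV_sum DERIV_cmult)
    then show ?thesis
      by (simp add: fwd_diff_def sum_distrib_left mult_ac)
  qed
  have "\<exists>l z. x < z \<and> z < x + 1 \<and> DERIV g z :> l \<and> g (x + 1) - g x = (x + 1 - x) * l"
    by (rule MVT) (use cont deriv in \<open>auto simp: real_differentiable_def\<close>)
  then obtain l z where z: "x < z" "DERIV g z :> l" "g (x + 1) - g x = l" by auto
  then have "l = \<beta> * fwd_diff m (\<lambda>i. (z + real i) powr (\<beta> - 1))"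
    using DERIV_unique deriv by blast
  moreover have "fwd_diff (Suc m) (\<lambda>i. (x + real i) powr \<beta>) = g (x + 1) - g x"
    by (simp add: fwd_diff_Suc g_def add_ac)
  ultimately show ?thesis using that[of z] z assms by auto
qed

text \<open>
  Iterating the mean value step gives the discrete counterpart of the \<open>m\<close>-th derivative. After the
  first step the base point is positive and the exponent is arbitrary; the induction is on this case.
\<close>

lemma fwd_diff_powr_pos:
  fixes x \<beta> :: real
  assumes "0 < x"
  shows "\<exists>\<xi>>0. fwd_diff m (\<lambda>i. (x + real i) powr \<beta>) = (\<Prod>i<m. \<beta> - real i) * \<xi> powr (\<beta> - real m)"
  using assms
proof (induction m arbitrary: x \<beta>)
  case (Suc m)
  obtain z where z: "0 < z"
    "fwd_diff (Suc m) (\<lambda>i. (x + real i) powr \<beta>) = \<beta> * fwd_diff m (\<lambda>i. (z + real i) powr (\<beta> - 1))"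
    using fwd_diff_powr_step Suc.prems by metis
  obtain \<xi> where "0 < \<xi>"
    "fwd_diff m (\<lambda>i. (z + real i) powr (\<beta> - 1)) = (\<Prod>i<m. \<beta> - 1 - real i) * \<xi> powr (\<beta> - 1 - real m)"
    using Suc.IH[OF z(1)] by blast
  with z show ?case
    by (intro exI[of _ \<xi>]) (simp add: prod.lessThan_Suc_shift algebra_simps del: prod.lessThan_Suc)
qed auto

lemma fwd_diff_powr:
  fixes \<alpha> :: real
  assumes "0 < \<alpha>" "0 < m"
  obtains \<xi> where "0 < \<xi>"
    and "fwd_diff m (\<lambda>i. real i powr \<alpha>) = (\<Prod>i<m. \<alpha> - real i) * \<xi> powr (\<alpha> - real m)"
proof -
  obtain l where m: "m = Suc l" using assms gr0_implies_Suc by blast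
  obtain z where z: "0 < z"
    "fwd_diff m (\<lambda>i. real i powr \<alpha>) = \<alpha> * fwd_diff l (\<lambda>i. (z + real i) powr (\<alpha> - 1))"
    using fwd_diff_powr_step[of 0 \<alpha> l] assms(1) by (auto simp: m)
  obtain \<xi> where "0 < \<xi>"
    "fwd_diff l (\<lambda>i. (z + real i) powr (\<alpha> - 1)) = (\<Prod>i<l. \<alpha> - 1 - real i) * \<xi> powr (\<alpha> - 1 - real l)"
    using fwd_diff_powr_pos[OF z(1)] by blast
  with z show ?thesis
    by (intro that[of \<xi>])
      (simp_all add: m prod.lessThan_Suc_shift algebra_simps del: prod.lessThan_Suc)
qed

lemma fwd_diff_powr_nonneg:
  assumes "0 < \<alpha>" "real j \<le> \<alpha>" "m \<le> Suc j"
  shows "0 \<le> fwd_diff m (\<lambda>i. real i powr \<alpha>)"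
proof (cases "m = 0")
  case False
  then obtain \<xi> where "0 < \<xi>"
    "fwd_diff m (\<lambda>i. real i powr \<alpha>) = (\<Prod>i<m. \<alpha> - real i) * \<xi> powr (\<alpha> - real m)"
    using fwd_diff_powr[of \<alpha> m] assms(1) by auto
  moreover have "0 \<le> (\<Prod>i<m. \<alpha> - real i)"
    using assms by (intro prod_nonneg) auto
  ultimately show ?thesis by simp
qed simp

text \<open>
  Among the factors \<open>\<alpha> - i\<close> with \<open>i < j + 2\<close> only the last one, \<open>\<alpha> - (j + 1)\<close>, is negative.
\<close>

lemma fwd_diff_powr_neg:
  assumes "real j < \<alpha>" "\<alpha> < real j + 1"
  shows "fwd_diff (j + 2) (\<lambda>i. real i powr \<alpha>) < 0"
proof -
  obtain \<xi> where \<xi>: "0 < \<xi>"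
    "fwd_diff (j + 2) (\<lambda>i. real i powr \<alpha>) = (\<Prod>i<j + 2. \<alpha> - real i) * \<xi> powr (\<alpha> - real (j + 2))"
    using fwd_diff_powr[of \<alpha> "j + 2"] assms by auto
  have "0 < (\<Prod>i<Suc j. \<alpha> - real i)"
    using assms by (intro prod_pos) auto
  then have "(\<Prod>i<j + 2. \<alpha> - real i) < 0"
    using assms by (simp add: mult_pos_neg)
  with \<xi> show ?thesis by (simp add: mult_neg_pos)
qed

section \<open>Moebius inversion and the existence of powers\<close>

text \<open>
  The direction of Moebius inversion that sums an alternating sum back up; it follows from the
  self-inverse form \<open>inclusion_exclusion_symmetric\<close> by moving the sign \<open>(-1) ^ card A\<close>.
\<close>

lemma alt_sum_Pow_inverse:
  fixes F :: "'a set \<Rightarrow> real"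
  assumes "finite S"
  shows "(\<Sum>A\<in>Pow S. \<Sum>T\<in>Pow A. (-1) ^ (card A - card T) * F T) = F S"
proof -
  define g where "g A = (\<Sum>T\<in>Pow A. (-1) ^ card T * F T)" for A
  have "F S = (\<Sum>A\<in>Pow S. (-1) ^ card A * g A)"
    by (rule inclusion_exclusion_symmetric) (auto simp: g_def assms)
  also have "\<dots> = (\<Sum>A\<in>Pow S. \<Sum>T\<in>Pow A. (-1) ^ (card A - card T) * F T)"
  proof (rule sum.cong)
    fix A assume "A \<in> Pow S"
    then have fin: "finite A" using assms finite_subset by auto
    have "(-1) ^ card A * ((-1) ^ card T * F T) = (-1) ^ (card A - card T) * F T" if "T \<subseteq> A" for T
      using card_mono[OF fin that]
      by (simp add: mult.assoc[symmetric] power_add[symmetric] neg_one_power_add_eq_neg_one_power_diff)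
    then show "(-1) ^ card A * g A = (\<Sum>T\<in>Pow A. (-1) ^ (card A - card T) * F T)"
      unfolding g_def sum_distrib_left by (intro sum.cong) auto
  qed simp
  finally show ?thesis by simp
qed

lemma sum_Pow_card:
  fixes g :: "nat \<Rightarrow> real"
  assumes "finite A"
  shows "(\<Sum>B\<in>Pow A. g (card B)) = (\<Sum>i\<le>card A. real (card A choose i) * g i)"
proof -
  have "(\<Sum>B\<in>Pow A. g (card B)) = (\<Sum>i\<le>card A. \<Sum>B | B \<in> Pow A \<and> card B = i. g (card B))"
    by (rule sum.group[symmetric]) (auto simp: assms card_mono)
  also have "\<dots> = (\<Sum>i\<le>card A. real (card A choose i) * g i)"
    by (simp add: n_subsets[OF assms])
  finally show ?thesis .
qed

lemma prob_subset_eq_sum: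
  assumes "random_subset n M X" "finite A"
  shows "\<P>(\<omega> in M. X \<omega> \<subseteq> A) = (\<Sum>B\<in>Pow A. \<P>(\<omega> in M. X \<omega> = B))"
proof -
  interpret prob_space M using assms(1) by (simp add: random_subset_def)
  have X: "X \<in> M \<rightarrow>\<^sub>M count_space (Pow {1..n})" using assms(1) by (simp add: random_subset_def)
  have "{\<omega>\<in>space M. X \<omega> = B} \<in> events" for B
  proof (cases "B \<subseteq> {1..n}")
    case True
    then have "X -` {B} \<inter> space M \<in> events" using X by (intro measurable_sets) auto
    then show ?thesis by (simp add: vimage_def Int_def conj_commute)
  next
    case False
    then have "{\<omega>\<in>space M. X \<omega> = B} = {}" using measurable_space[OF X] by auto
    then show ?thesis by (metis sets.empty_sets)
  qed
  then have "prob (\<Union>B\<in>Pow A. {\<omega>\<in>space M. X \<omega> = B}) = (\<Sum>B\<in>Pow A. \<P>(\<omega> in M. X \<omega> = B))"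
    using assms(2) by (intro finite_measure_finite_Union) (auto simp: disjoint_family_on_def)
  moreover have "(\<Union>B\<in>Pow A. {\<omega>\<in>space M. X \<omega> = B}) = {\<omega>\<in>space M. X \<omega> \<subseteq> A}" by auto
  ultimately show ?thesis by simp
qed

lemma prob_eq_alt_sum:
  assumes "random_subset n M X" "finite B"
  shows "\<P>(\<omega> in M. X \<omega> = B) = (\<Sum>A\<in>Pow B. (-1) ^ (card B - card A) * \<P>(\<omega> in M. X \<omega> \<subseteq> A))"
  by (rule inclusion_exclusion_mobius) (use assms prob_subset_eq_sum in auto)

lemma void_functional_complement:
  assumes "random_subset n M X" "A \<subseteq> {1..n}"
  shows "void_functional M X ({1..n} - A) = \<P>(\<omega> in M. X \<omega> \<subseteq> A)"
proof -
  have X: "X \<in> M \<rightarrow>\<^sub>M count_space (Pow {1..n})" using assms(1) by (simp add: random_subset_def)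
  have "{\<omega>\<in>space M. X \<omega> \<inter> ({1..n} - A) = {}} = {\<omega>\<in>space M. X \<omega> \<subseteq> A}"
    using measurable_space[OF X] by auto
  then show ?thesis by (simp add: void_functional_def)
qed

lemma random_subset_point_measure:
  fixes w :: "nat set \<Rightarrow> real"
  assumes w: "\<And>A. A \<subseteq> {1..n} \<Longrightarrow> 0 \<le> w A" and sum1: "(\<Sum>A\<in>Pow {1..n}. w A) = 1"
  defines "M \<equiv> point_measure (Pow {1..n}) (\<lambda>A. ennreal (w A))"
  shows "random_subset n M (\<lambda>A. A)"
    and "A \<subseteq> {1..n} \<Longrightarrow> \<P>(\<omega> in M. \<omega> = A) = w A"
    and "A \<subseteq> {1..n} \<Longrightarrow> \<P>(\<omega> in M. \<omega> \<subseteq> A) = (\<Sum>B\<in>Pow A. w B)"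
proof -
  have "(\<Sum>A\<in>Pow {1..n}. ennreal (w A)) = 1"
    using w sum1 by (subst sum_ennreal) auto
  then have "prob_space M"
    unfolding M_def by (intro prob_space_point_measure) auto
  then show "random_subset n M (\<lambda>A. A)"
    by (simp add: random_subset_def M_def space_point_measure)
  have meas: "measure M S = (\<Sum>A\<in>S. w A)" if "S \<subseteq> Pow {1..n}" for S
  proof -
    have "emeasure M S = (\<Sum>A\<in>S. ennreal (w A))"
      unfolding M_def by (rule emeasure_point_measure_finite) (use that in auto)
    also have "\<dots> = ennreal (\<Sum>A\<in>S. w A)" using that w by (intro sum_ennreal) auto
    finally show ?thesis using that w by (simp add: measure_def sum_nonneg subset_iff)
  qed
  assume A: "A \<subseteq> {1..n}"
  have "{\<omega>\<in>space M. \<omega> = A} = {A}" "{\<omega>\<in>space M. \<omega> \<subseteq> A} = Pow A"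
    using A by (auto simp: M_def space_point_measure)
  then show "\<P>(\<omega> in M. \<omega> = A) = w A" "\<P>(\<omega> in M. \<omega> \<subseteq> A) = (\<Sum>B\<in>Pow A. w B)"
    using A meas[of "{A}"] meas[of "Pow A"] by auto
qed

text \<open>
  The law of \<open>X\<^sub>\<alpha>\<close> has no choice: it must be the Moebius inverse of \<open>A \<mapsto> F(A)\<^sup>\<alpha>\<close>. This inverse always
  has total mass \<open>F({1..n})\<^sup>\<alpha> = 1\<close>, so it is a law as soon as it is nonnegative.
\<close>

lemma power_exists_iff:
  assumes "random_subset n M X"
  shows "power_exists n M X \<alpha> \<longleftrightarrow> (\<forall>B\<subseteq>{1..n}. 0 \<le> subset_alt_sum M X B \<alpha>)"
proof
  assume "power_exists n M X \<alpha>"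
  then obtain N :: "nat set measure" and Y where Y: "random_subset n N Y"
    and V: "\<And>K. K \<subseteq> {1..n} \<Longrightarrow> void_functional N Y K = void_functional M X K powr \<alpha>"
    unfolding power_exists_def by blast
  have eq: "\<P>(\<omega> in N. Y \<omega> \<subseteq> A) = \<P>(\<omega> in M. X \<omega> \<subseteq> A) powr \<alpha>" if "A \<subseteq> {1..n}" for A
    using V[of "{1..n} - A"] void_functional_complement[OF Y that]
      void_functional_complement[OF assms that] by simp
  show "\<forall>B\<subseteq>{1..n}. 0 \<le> subset_alt_sum M X B \<alpha>"
  proof (intro allI impI)
    fix B assume B: "B \<subseteq> {1..n}"
    have "subset_alt_sum M X B \<alpha>
        = (\<Sum>A\<in>Pow B. (-1) ^ (card B - card A) * \<P>(\<omega> in N. Y \<omega> \<subseteq> A))"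
      unfolding subset_alt_sum_def by (rule sum.cong) (use eq B in \<open>simp_all add: subset_trans\<close>)
    also have "\<dots> = \<P>(\<omega> in N. Y \<omega> = B)"
      by (rule prob_eq_alt_sum[symmetric]) (use Y B finite_subset in auto)
    finally have "subset_alt_sum M X B \<alpha> = \<P>(\<omega> in N. Y \<omega> = B)" .
    then show "0 \<le> subset_alt_sum M X B \<alpha>" by simp
  qed
next
  assume nonneg: "\<forall>B\<subseteq>{1..n}. 0 \<le> subset_alt_sum M X B \<alpha>"
  interpret prob_space M using assms by (simp add: random_subset_def)
  have X: "X \<in> M \<rightarrow>\<^sub>M count_space (Pow {1..n})" using assms by (simp add: random_subset_def)
  have total: "(\<Sum>B\<in>Pow A. subset_alt_sum M X B \<alpha>) = \<P>(\<omega> in M. X \<omega> \<subseteq> A) powr \<alpha>"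
    if "A \<subseteq> {1..n}" for A
    unfolding subset_alt_sum_def by (rule alt_sum_Pow_inverse) (use that finite_subset in auto)
  have "{\<omega>\<in>space M. X \<omega> \<subseteq> {1..n}} = space M" using measurable_space[OF X] by auto
  then have sum1: "(\<Sum>B\<in>Pow {1..n}. subset_alt_sum M X B \<alpha>) = 1"
    using total[of "{1..n}"] by (simp add: prob_space)
  define N where "N = point_measure (Pow {1..n}) (\<lambda>B. ennreal (subset_alt_sum M X B \<alpha>))"
  note law = random_subset_point_measure[where w = "\<lambda>B. subset_alt_sum M X B \<alpha>", OF _ sum1, folded N_def]
  have N: "random_subset n N (\<lambda>A. A)"
    using nonneg by (intro law(1)) auto
  have N_subset: "\<P>(\<omega> in N. \<omega> \<subseteq> A) = (\<Sum>B\<in>Pow A. subset_alt_sum M X B \<alpha>)" if "A \<subseteq> {1..n}" for A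
    using nonneg that by (intro law(3)) auto
  show "power_exists n M X \<alpha>"
  proof (rule power_existsI[OF N])
    fix K assume "K \<subseteq> {1..n}"
    define A where "A = {1..n} - K"
    have A: "A \<subseteq> {1..n}" by (auto simp: A_def)
    have K: "{1..n} - A = K" using \<open>K \<subseteq> {1..n}\<close> by (auto simp: A_def)
    have "\<P>(\<omega> in N. \<omega> \<subseteq> A) = \<P>(\<omega> in M. X \<omega> \<subseteq> A) powr \<alpha>"
      by (simp only: N_subset[OF A] total[OF A])
    then show "void_functional N (\<lambda>A. A) K = void_functional M X K powr \<alpha>"
      using void_functional_complement[OF N A] void_functional_complement[OF assms A]
      by (simp only: K)
  qed
qed

section \<open>Positivity at and near the integers\<close>

text \<open>
  In probabilistic terms: two independent random sets both lie inside \<open>A\<close> exactly when their union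
  does.
\<close>

lemma sum_Pow_mult:
  fixes q p :: "'a set \<Rightarrow> real"
  assumes "finite A"
  shows "(\<Sum>B\<in>Pow A. q B) * (\<Sum>C\<in>Pow A. p C) =
    (\<Sum>D\<in>Pow A. \<Sum>(B, C) | B \<subseteq> D \<and> C \<subseteq> D \<and> B \<union> C = D. q B * p C)"
proof -
  have "(\<Sum>B\<in>Pow A. q B) * (\<Sum>C\<in>Pow A. p C) = (\<Sum>(B, C)\<in>Pow A \<times> Pow A. q B * p C)"
    by (simp add: sum_product sum.cartesian_product)
  also have "\<dots> = (\<Sum>D\<in>Pow A. \<Sum>(B, C) | (B, C) \<in> Pow A \<times> Pow A \<and> (\<lambda>(B, C). B \<union> C) (B, C) = D. q B * p C)"
    by (subst sum.group[where g = "\<lambda>(B, C). B \<union> C" and T = "Pow A", symmetric])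
      (auto simp: assms case_prod_beta intro!: sum.cong)
  also have "\<dots> = (\<Sum>D\<in>Pow A. \<Sum>(B, C) | B \<subseteq> D \<and> C \<subseteq> D \<and> B \<union> C = D. q B * p C)"
    by (intro sum.cong) auto
  finally show ?thesis .
qed

text \<open>
  The weights \<open>\<mu>\<close> are those of the union of \<open>j + 1\<close> independent sets with weights \<open>q\<close>. The lower bound is
  the contribution of the case where all of these sets equal \<open>A\<close>.
\<close>

lemma power_sum_Pow:
  fixes q :: "'a set \<Rightarrow> real"
  assumes "\<And>B. 0 \<le> q B"
  shows "\<exists>\<mu>. (\<forall>A. 0 \<le> \<mu> A) \<and> (\<forall>A. finite A \<longrightarrow> q A ^ Suc j \<le> \<mu> A) \<and>
    (\<forall>A. finite A \<longrightarrow> (\<Sum>B\<in>Pow A. q B) ^ Suc j = (\<Sum>B\<in>Pow A. \<mu> B))"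
proof (induction j)
  case 0
  then show ?case using assms by (intro exI[of _ q]) auto
next
  case (Suc j)
  then obtain \<mu> where \<mu>: "\<And>A. 0 \<le> \<mu> A" "\<And>A. finite A \<Longrightarrow> q A ^ Suc j \<le> \<mu> A"
    "\<And>A. finite A \<Longrightarrow> (\<Sum>B\<in>Pow A. q B) ^ Suc j = (\<Sum>B\<in>Pow A. \<mu> B)" by blast
  define \<nu> where "\<nu> D = (\<Sum>(B, C) | B \<subseteq> D \<and> C \<subseteq> D \<and> B \<union> C = D. q B * \<mu> C)" for D
  have "0 \<le> \<nu> D" for D
    unfolding \<nu>_def using assms \<mu>(1) by (intro sum_nonneg) auto
  moreover have "q D ^ Suc (Suc j) \<le> \<nu> D" if "finite D" for D
  proof -
    have "finite {(B, C). B \<subseteq> D \<and> C \<subseteq> D \<and> B \<union> C = D}"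
      by (rule finite_subset[of _ "Pow D \<times> Pow D"]) (use that in auto)
    then have "(\<lambda>(B, C). q B * \<mu> C) (D, D) \<le> \<nu> D"
      unfolding \<nu>_def using assms \<mu>(1) by (intro member_le_sum) auto
    moreover have "q D * q D ^ Suc j \<le> q D * \<mu> D"
      using assms \<mu>(2) that by (intro mult_left_mono) auto
    ultimately show ?thesis by simp
  qed
  moreover have "(\<Sum>B\<in>Pow A. q B) ^ Suc (Suc j) = (\<Sum>B\<in>Pow A. \<nu> B)" if "finite A" for A
    using \<mu>(3)[OF that] sum_Pow_mult[OF that, of q \<mu>] by (simp add: \<nu>_def)
  ultimately show ?case by blast
qed

lemma subset_alt_sum_nat_pos:
  assumes "random_subset n M X" "finite B" "0 < \<P>(\<omega> in M. X \<omega> = B)" "1 \<le> j"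
  shows "0 < subset_alt_sum M X B (real j)"
proof -
  obtain i where j: "j = Suc i" using assms(4) by (metis Suc_le_D One_nat_def)
  obtain \<mu> where \<mu>: "\<P>(\<omega> in M. X \<omega> = B) ^ j \<le> \<mu> B"
    "\<And>A. finite A \<Longrightarrow> (\<Sum>B\<in>Pow A. \<P>(\<omega> in M. X \<omega> = B)) ^ j = (\<Sum>B\<in>Pow A. \<mu> B)"
    using power_sum_Pow[of "\<lambda>B. \<P>(\<omega> in M. X \<omega> = B)" i] assms(2) by (auto simp: j)
  have "\<mu> B = subset_alt_sum M X B (real j)"
    unfolding subset_alt_sum_def
    by (rule inclusion_exclusion_mobius)
      (use assms in \<open>auto simp: powr_realpow' \<mu>(2)[symmetric] prob_subset_eq_sum[OF assms(1)] sum_nonneg\<close>)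
  then show ?thesis using \<mu>(1) assms(3) by (metis less_le_trans zero_less_power)
qed

lemma isCont_subset_alt_sum: "isCont (subset_alt_sum M X B) \<alpha>"
proof -
  \<comment> \<open>At \<open>c = 0\<close> the power is the constant 0, also at the exponent 0.\<close>
  have "isCont (\<lambda>\<alpha>. c powr \<alpha>) \<alpha>" for c :: real
    by (cases "c = 0") (auto intro!: continuous_intros)
  then show ?thesis
    unfolding subset_alt_sum_def[abs_def] by (intro continuous_sum continuous_mult continuous_const)
qed

section \<open>Random subsets whose law depends only on the cardinality\<close>

text \<open>
  Grouping the subsets of \<open>B\<close> by cardinality turns Moebius inversion into a forward difference. The
  normalising constant \<open>f n\<close> contributes only a positive factor, so the unnormalised weights \<open>w\<close>
  decide all signs.
\<close>

lemma exchangeable_subset: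
  fixes w :: "nat \<Rightarrow> real"
  defines "f m \<equiv> \<Sum>i\<le>m. real (m choose i) * w i"
  assumes w: "\<And>i. 0 \<le> w i" and pos: "0 < f n"
  obtains M :: "nat set measure" where "random_subset n M (\<lambda>A. A)"
    and "\<And>A. A \<subseteq> {1..n} \<Longrightarrow> \<P>(\<omega> in M. \<omega> = A) = w (card A) / f n"
    and "\<And>B \<alpha>. B \<subseteq> {1..n} \<Longrightarrow>
      subset_alt_sum M (\<lambda>A. A) B \<alpha> = fwd_diff (card B) (\<lambda>i. f i powr \<alpha>) / f n powr \<alpha>"
proof -
  have Pow: "(\<Sum>B\<in>Pow A. w (card B) / f n) = f (card A) / f n" if "A \<subseteq> {1..n}" for A
    using sum_Pow_card[of A "\<lambda>i. w i / f n"] finite_subset[OF that]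
    by (simp add: f_def[of "card A"] sum_divide_distrib)
  define M where "M = point_measure (Pow {1..n}) (\<lambda>A. ennreal (w (card A) / f n))"
  have "(\<Sum>A\<in>Pow {1..n}. w (card A) / f n) = 1" using Pow[of "{1..n}"] pos by simp
  note M = random_subset_point_measure[where w = "\<lambda>A. w (card A) / f n", OF _ this, folded M_def]
  have f: "0 \<le> f m" for m unfolding f_def using w by (simp add: sum_nonneg)
  show ?thesis
  proof (rule that)
    show "random_subset n M (\<lambda>A. A)" using M(1) w f by simp
    show "\<P>(\<omega> in M. \<omega> = A) = w (card A) / f n" if "A \<subseteq> {1..n}" for A
      using M(2) w f that by simp
    show "subset_alt_sum M (\<lambda>A. A) B \<alpha> = fwd_diff (card B) (\<lambda>i. f i powr \<alpha>) / f n powr \<alpha>"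
      if B: "B \<subseteq> {1..n}" for B \<alpha>
    proof -
      have "subset_alt_sum M (\<lambda>A. A) B \<alpha>
          = (\<Sum>A\<in>Pow B. (-1) ^ (card B - card A) * (f (card A) / f n) powr \<alpha>)"
        unfolding subset_alt_sum_def
        by (rule sum.cong) (use M(3) Pow w f B in \<open>auto simp: subset_trans\<close>)
      also have "\<dots> = (\<Sum>i\<le>card B. real (card B choose i) * ((-1) ^ (card B - i) * (f i / f n) powr \<alpha>))"
        by (rule sum_Pow_card) (use B finite_subset in auto)
      also have "\<dots> = fwd_diff (card B) (\<lambda>i. f i powr \<alpha>) / f n powr \<alpha>"
        by (simp add: fwd_diff_def sum_divide_distrib powr_divide f mult_ac)
      finally show ?thesis .
    qed
  qed
qed


section \<open>Choosing the two small parameters\<close>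

lemma fwd_diff_tendsto_powr:
  assumes "\<And>i. ((\<lambda>\<epsilon>. f \<epsilon> i) \<longlongrightarrow> real i) F" "\<And>i. \<forall>\<^sub>F \<epsilon> in F. 0 \<le> f \<epsilon> i" "0 < \<alpha>"
  shows "((\<lambda>\<epsilon>. fwd_diff m (\<lambda>i. f \<epsilon> i powr \<alpha>)) \<longlongrightarrow> fwd_diff m (\<lambda>i. real i powr \<alpha>)) F"
  unfolding fwd_diff_def
  by (intro tendsto_sum tendsto_mult tendsto_const tendsto_powr2) (use assms in auto)

text \<open>
  This yields one radius \<open>\<delta>\<close> for all the sets \<open>B\<close> and all the integers \<open>j\<close> at once. The bound
  \<open>\<delta> \<le> 1\<close> keeps \<open>[j, j + \<delta>)\<close> inside \<open>[j, j + 1)\<close>.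
\<close>

lemma pos_near_finitely_many:
  fixes r :: "'b \<Rightarrow> real \<Rightarrow> real"
  assumes "finite S" and "\<And>b x. (b, x) \<in> S \<Longrightarrow> isCont (r b) x \<and> 0 < r b x"
  shows "\<exists>\<delta>>0. \<delta> \<le> 1 \<and> (\<forall>(b, x)\<in>S. \<forall>\<alpha>\<in>{x - \<delta><..<x + \<delta>}. 0 < r b \<alpha>)"
  using assms
proof (induction S)
  case empty
  show ?case by (intro exI[of _ 1]) auto
next
  case (insert s S)
  obtain b x where s: "s = (b, x)" by fastforce
  obtain \<delta> where \<delta>: "0 < \<delta>" "\<delta> \<le> 1" "\<forall>(b, x)\<in>S. \<forall>\<alpha>\<in>{x - \<delta><..<x + \<delta>}. 0 < r b \<alpha>"
    using insert by auto
  have "(r b \<longlongrightarrow> r b x) (at x)" "0 < r b x"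
    using insert.prems[of b x] s by (auto simp: isCont_def)
  then have "\<forall>\<^sub>F \<alpha> in at x. 0 < r b \<alpha>" by (rule order_tendstoD)
  then obtain d where d: "0 < d" "\<And>\<alpha>. \<alpha> \<noteq> x \<Longrightarrow> dist \<alpha> x < d \<Longrightarrow> 0 < r b \<alpha>"
    by (auto simp: eventually_at)
  then have "0 < r b \<alpha>" if "\<alpha> \<in> {x - d<..<x + d}" for \<alpha>
    using that \<open>0 < r b x\<close> by (cases "\<alpha> = x") (auto simp: dist_real_def)
  moreover have "0 < r c \<alpha>" if "(c, y) \<in> S" "\<alpha> \<in> {y - \<delta><..<y + \<delta>}" for c y \<alpha>
    using \<delta>(3) that by blast
  ultimately show ?case
    using \<delta>(1,2) d(1) by (intro exI[of _ "min \<delta> d"]) (auto simp: s split: if_splits simp: min_def)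
qed

theorem theorem10:
  fixes n k :: nat
  assumes "n \<ge> 4" and "2 \<le> k" and "k \<le> n - 2"
  shows "\<exists>(\<delta>::real) (M :: nat set measure) (X :: nat set \<Rightarrow> nat set).
    \<delta> > 0 \<and> random_subset n M X \<and>
    (\<forall>A B. A \<subseteq> {1..n} \<and> B \<subseteq> {1..n} \<and> card A = card B \<longrightarrow>
       \<P>(\<omega> in M. X \<omega> = A) = \<P>(\<omega> in M. X \<omega> = B)) \<and>
    (\<forall>A \<subseteq> {1..n}. \<P>(\<omega> in M. X \<omega> = A) = 0 \<longleftrightarrow>
       A = {} \<or> (1 < card A \<and> card A \<le> n - k + 1)) \<and>
    (\<forall>\<alpha>::real. 0 < \<alpha> \<and> \<alpha> \<le> real (n - k - 1) \<and> \<alpha> \<notin> \<int> \<longrightarrow> \<not> power_exists n M X \<alpha>) \<and>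
    (\<forall>j::nat. n - k \<le> j \<and> j \<le> n - 2 \<longrightarrow>
       (\<forall>\<alpha>::real. \<alpha> \<in> {real j..<real j + \<delta>} \<longrightarrow> power_exists n M X \<alpha>)) \<and>
    (\<forall>j::nat. n - k \<le> j \<and> j \<le> n - 2 \<longrightarrow>
       (\<exists>\<alpha>::real. \<alpha> \<in> {real j<..<real j + 1} \<and> \<not> power_exists n M X \<alpha>)) \<and>
    (\<forall>B \<subseteq> {1..n}. card B \<ge> n - k + 2 \<longrightarrow>
       (\<forall>j::nat. 1 \<le> j \<and> j \<le> n - 2 \<longrightarrow>
          (\<forall>\<alpha>::real. 0 < \<alpha> \<and> \<alpha> \<in> {real j - \<delta><..<real j + \<delta>} \<longrightarrow>
             subset_alt_sum M X B \<alpha> > 0)))"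
proof -
  define s where "s = n - k + 2"
  have s: "4 \<le> s" "s \<le> n" using assms by (auto simp: s_def)
  define w where "w \<epsilon> i = (if i = 1 then 1 else if s \<le> i then \<epsilon> else 0)" for \<epsilon> :: real and i :: nat
  define f where "f \<epsilon> m = (\<Sum>i\<le>m. real (m choose i) * w \<epsilon> i)" for \<epsilon> and m :: nat
  \<comment> \<open>The value at \<open>\<epsilon> = 0\<close>, where only singletons carry weight.\<close>
  have linear: "(\<Sum>i\<le>m. real (m choose i) * (if i = 1 then 1 else 0)) = real m" for m
    by (simp add: if_distrib[of "\<lambda>x. _ * x"] sum.delta cong: if_cong)
  have f_small: "f \<epsilon> m = real m" if "m < s" for \<epsilon> m
  proof -
    have "f \<epsilon> m = (\<Sum>i\<le>m. real (m choose i) * (if i = 1 then 1 else 0))"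
      unfolding f_def by (rule sum.cong) (use that in \<open>auto simp: w_def\<close>)
    then show ?thesis by (simp only: linear)
  qed
  have "((\<lambda>\<epsilon>. w \<epsilon> i) \<longlongrightarrow> (if i = 1 then 1 else 0)) (at_right 0)" for i
    by (cases "i = 1"; cases "s \<le> i") (simp_all add: w_def tendsto_ident_at)
  then have "((\<lambda>\<epsilon>. f \<epsilon> m) \<longlongrightarrow> (\<Sum>i\<le>m. real (m choose i) * (if i = 1 then 1 else 0))) (at_right 0)" for m
    unfolding f_def by (intro tendsto_sum tendsto_mult tendsto_const)
  then have f_lim: "((\<lambda>\<epsilon>. f \<epsilon> m) \<longlongrightarrow> real m) (at_right 0)" for m
    by (simp only: linear)
  have w_nonneg: "0 \<le> w \<epsilon> i" if "0 < \<epsilon>" for \<epsilon> i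
    using that by (simp add: w_def)
  then have "0 \<le> f \<epsilon> m" if "0 < \<epsilon>" for \<epsilon> m
    using that by (simp add: f_def sum_nonneg)
  then have f_ev: "\<forall>\<^sub>F \<epsilon> in at_right 0. 0 \<le> f \<epsilon> m" for m
    using eventually_at_right_less[of "0::real"] by (auto elim: eventually_mono)

  \<comment> \<open>Any fixed exponent in \<open>(j, j + 1)\<close> would do in place of \<open>j + 1/2\<close>.\<close>
  have "\<forall>\<^sub>F \<epsilon> in at_right 0. \<forall>j\<in>{n - k..n - 2}.
      fwd_diff (j + 2) (\<lambda>i. f \<epsilon> i powr (real j + 1 / 2)) < 0"
  proof (intro eventually_ball_finite ballI)
    fix j
    show "\<forall>\<^sub>F \<epsilon> in at_right 0. fwd_diff (j + 2) (\<lambda>i. f \<epsilon> i powr (real j + 1 / 2)) < 0"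
      by (rule order_tendstoD(2)[OF fwd_diff_tendsto_powr[OF f_lim f_ev] fwd_diff_powr_neg]) auto
  qed simp
  then have "\<forall>\<^sub>F \<epsilon> in at_right 0. 0 < \<epsilon> \<and> (\<forall>j\<in>{n - k..n - 2}.
      fwd_diff (j + 2) (\<lambda>i. f \<epsilon> i powr (real j + 1 / 2)) < 0)"
    using eventually_at_right_less[of "0::real"] by eventually_elim auto
  then have "\<exists>\<epsilon>. 0 < \<epsilon> \<and> (\<forall>j\<in>{n - k..n - 2}.
      fwd_diff (j + 2) (\<lambda>i. f \<epsilon> i powr (real j + 1 / 2)) < 0)"
    by (rule eventually_happens'[rotated]) simp
  then obtain \<epsilon> where \<epsilon>: "0 < \<epsilon>" and
    neg: "\<And>j. n - k \<le> j \<Longrightarrow> j \<le> n - 2 \<Longrightarrow> fwd_diff (j + 2) (\<lambda>i. f \<epsilon> i powr (real j + 1 / 2)) < 0"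
    by (metis atLeastAtMost_iff)

  have "real (n choose 1) * w \<epsilon> 1 \<le> f \<epsilon> n"
    unfolding f_def by (rule member_le_sum) (use s w_nonneg[OF \<epsilon>] in auto)
  then have fn: "0 < f \<epsilon> n" using s by (simp add: w_def)
  obtain M :: "nat set measure" where M: "random_subset n M (\<lambda>A. A)"
    and law: "\<And>A. A \<subseteq> {1..n} \<Longrightarrow> \<P>(\<omega> in M. \<omega> = A) = w \<epsilon> (card A) / f \<epsilon> n"
    and alt: "\<And>B \<alpha>. B \<subseteq> {1..n} \<Longrightarrow> subset_alt_sum M (\<lambda>A. A) B \<alpha>
      = fwd_diff (card B) (\<lambda>i. f \<epsilon> i powr \<alpha>) / f \<epsilon> n powr \<alpha>"
    by (rule exchangeable_subset[of "w \<epsilon>" n, folded f_def, OF w_nonneg[OF \<epsilon>] fn]) (rule that)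
  have alt_small: "subset_alt_sum M (\<lambda>A. A) B \<alpha> = fwd_diff (card B) (\<lambda>i. real i powr \<alpha>) / f \<epsilon> n powr \<alpha>"
    if "B \<subseteq> {1..n}" "card B < s" for B \<alpha>
  proof -
    have "fwd_diff (card B) (\<lambda>i. f \<epsilon> i powr \<alpha>) = fwd_diff (card B) (\<lambda>i. real i powr \<alpha>)"
      unfolding fwd_diff_def by (rule sum.cong) (use that f_small in auto)
    then show ?thesis using alt that by simp
  qed
  have not_exists: "\<not> power_exists n M (\<lambda>A. A) \<alpha>"
    if "m \<le> n" "fwd_diff m (\<lambda>i. f \<epsilon> i powr \<alpha>) < 0" for m \<alpha>
  proof -
    have "subset_alt_sum M (\<lambda>A. A) {1..m} \<alpha> < 0"
      using alt[of "{1..m}" \<alpha>] that fn by (simp add: divide_neg_pos)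
    then show ?thesis unfolding power_exists_iff[OF M] using that
      by (auto simp: not_le intro!: exI[of _ "{1..m}"])
  qed

  define S where "S = {B. B \<subseteq> {1..n} \<and> s \<le> card B} \<times> real ` {1..n - 2}"
  have "finite S" by (simp add: S_def)
  moreover have "isCont (subset_alt_sum M (\<lambda>A. A) B) x \<and> 0 < subset_alt_sum M (\<lambda>A. A) B x"
    if "(B, x) \<in> S" for B x
  proof
    show "0 < subset_alt_sum M (\<lambda>A. A) B x"
      using that law[of B] fn \<epsilon> s finite_subset[of B "{1..n}"] subset_alt_sum_nat_pos[OF M, of B]
      by (auto simp: S_def w_def)
  qed (rule isCont_subset_alt_sum)
  ultimately obtain \<delta> where \<delta>: "0 < \<delta>" "\<delta> \<le> 1" and
    pos: "\<And>B x \<alpha>. (B, x) \<in> S \<Longrightarrow> \<alpha> \<in> {x - \<delta><..<x + \<delta>} \<Longrightarrow> 0 < subset_alt_sum M (\<lambda>A. A) B \<alpha>"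
    using pos_near_finitely_many[of S "subset_alt_sum M (\<lambda>A. A)"] by fast

  show ?thesis
  proof (rule exI[of _ \<delta>], rule exI[of _ M], rule exI[of _ "\<lambda>A. A"], intro conjI)
    show "\<forall>A B. A \<subseteq> {1..n} \<and> B \<subseteq> {1..n} \<and> card A = card B \<longrightarrow>
        \<P>(\<omega> in M. \<omega> = A) = \<P>(\<omega> in M. \<omega> = B)"
      by (clarify; simp only: law)
    show "\<forall>A\<subseteq>{1..n}. \<P>(\<omega> in M. \<omega> = A) = 0 \<longleftrightarrow> A = {} \<or> 1 < card A \<and> card A \<le> n - k + 1"
    proof (intro allI impI)
      fix A assume A: "A \<subseteq> {1..n}"
      then have "card A = 0 \<longleftrightarrow> A = {}" using finite_subset by fastforce
      then show "\<P>(\<omega> in M. \<omega> = A) = 0 \<longleftrightarrow> A = {} \<or> 1 < card A \<and> card A \<le> n - k + 1"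
        unfolding law[OF A] using fn \<epsilon> s by (auto simp: w_def s_def)
    qed
    show "\<forall>\<alpha>::real. 0 < \<alpha> \<and> \<alpha> \<le> real (n - k - 1) \<and> \<alpha> \<notin> \<int> \<longrightarrow> \<not> power_exists n M (\<lambda>A. A) \<alpha>"
    proof (intro allI impI)
      fix \<alpha> :: real assume \<alpha>: "0 < \<alpha> \<and> \<alpha> \<le> real (n - k - 1) \<and> \<alpha> \<notin> \<int>"
      define j where "j = nat \<lfloor>\<alpha>\<rfloor>"
      have "real j \<le> \<alpha>" "\<alpha> < real j + 1" using \<alpha> by (auto simp: j_def)
      moreover have "real j \<noteq> \<alpha>" using \<alpha> by (metis Ints_of_nat)
      ultimately have j: "real j < \<alpha>" "\<alpha> < real j + 1" by auto
      with \<alpha> have "real j < real (n - k - 1)" by linarith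
      then have "j + 2 < s" by (simp add: s_def)
      have "fwd_diff (j + 2) (\<lambda>i. f \<epsilon> i powr \<alpha>) = fwd_diff (j + 2) (\<lambda>i. real i powr \<alpha>)"
        unfolding fwd_diff_def by (rule sum.cong) (use \<open>j + 2 < s\<close> f_small in auto)
      with j have "fwd_diff (j + 2) (\<lambda>i. f \<epsilon> i powr \<alpha>) < 0" by (simp only: fwd_diff_powr_neg)
      then show "\<not> power_exists n M (\<lambda>A. A) \<alpha>"
        by (rule not_exists[rotated]) (use \<open>j + 2 < s\<close> s in simp)
    qed
    show "\<forall>j::nat. n - k \<le> j \<and> j \<le> n - 2 \<longrightarrow>
       (\<forall>\<alpha>::real. \<alpha> \<in> {real j..<real j + \<delta>} \<longrightarrow> power_exists n M (\<lambda>A. A) \<alpha>)"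
    proof (intro allI impI)
      fix j \<alpha> assume j: "n - k \<le> j \<and> j \<le> n - 2" and \<alpha>: "\<alpha> \<in> {real j..<real j + \<delta>}"
      have "1 \<le> j" using j assms by linarith
      show "power_exists n M (\<lambda>A. A) \<alpha>"
        unfolding power_exists_iff[OF M]
      proof (intro allI impI)
        fix B assume B: "B \<subseteq> {1..n}"
        show "0 \<le> subset_alt_sum M (\<lambda>A. A) B \<alpha>"
        proof (cases "s \<le> card B")
          case True
          then show ?thesis using pos[of B "real j" \<alpha>] B j \<open>1 \<le> j\<close> \<alpha> \<delta> by (auto simp: S_def)
        next
          case False
          then have "card B \<le> Suc j" using j by (simp add: s_def)
          then show ?thesis
            using False B \<alpha> \<open>1 \<le> j\<close> by (auto simp: alt_small intro!: divide_nonneg_nonneg fwd_diff_powr_nonneg)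
        qed
      qed
    qed
    show "\<forall>j::nat. n - k \<le> j \<and> j \<le> n - 2 \<longrightarrow>
       (\<exists>\<alpha>::real. \<alpha> \<in> {real j<..<real j + 1} \<and> \<not> power_exists n M (\<lambda>A. A) \<alpha>)"
    proof (intro allI impI)
      fix j assume j: "n - k \<le> j \<and> j \<le> n - 2"
      then have "\<not> power_exists n M (\<lambda>A. A) (real j + 1 / 2)"
        by (intro not_exists[of "j + 2"] neg) (use assms in auto)
      then show "\<exists>\<alpha>::real. \<alpha> \<in> {real j<..<real j + 1} \<and> \<not> power_exists n M (\<lambda>A. A) \<alpha>"
        by (intro exI[of _ "real j + 1 / 2"]) auto
    qed
    show "\<forall>B \<subseteq> {1..n}. card B \<ge> n - k + 2 \<longrightarrow>
       (\<forall>j::nat. 1 \<le> j \<and> j \<le> n - 2 \<longrightarrow>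
          (\<forall>\<alpha>::real. 0 < \<alpha> \<and> \<alpha> \<in> {real j - \<delta><..<real j + \<delta>} \<longrightarrow>
             subset_alt_sum M (\<lambda>A. A) B \<alpha> > 0))"
    proof (intro allI impI)
      fix B j and \<alpha> :: real
      assume "B \<subseteq> {1..n}" "card B \<ge> n - k + 2" "1 \<le> j \<and> j \<le> n - 2"
        and "0 < \<alpha> \<and> \<alpha> \<in> {real j - \<delta><..<real j + \<delta>}"
      then show "subset_alt_sum M (\<lambda>A. A) B \<alpha> > 0"
        using pos[of B "real j" \<alpha>] by (auto simp: S_def s_def)
    qed
  qed (use \<delta> M in auto)
qed

end
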